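(* Let $\mathcal{U}$ and $\mathcal{Y}$ be (nonempty) complete metric spaces. Let $\mathcal{R}$ be a behavior with input-value space $\mathcal{U}$ and output-value space $\mathcal{Y}$, and let $\mathcal{S}$ be a behavior with input-value space $\mathcal{Y}$ and output-value space $\mathcal{U}$. Suppose that $\mathcal{R}$ and $\mathcal{S}$ have Cauchy gains $\gamma_1,\gamma_2\in\mathcal{K}_\infty$ respectively, and incremental limit gains $\kappa_1,\kappa_2\in\mathcal{K}_\infty$ respectively, and that $$\gamma_1(\gamma_2(r))<r \quad\text{and}\quad \kappa_1(\kappa_2(r))<r\qquad\text{for all } r>0 .$$ Then there exist two elements $\bar u\in\mathcal{U}$ and $\bar y\in\mathcal{Y}$ such that, for every input/output pair $(\omega,\eta)\in\mathcal{R}\cap\mathcal{S}^{-1}$ for which $\|\omega\|_{\mathrm{aa}}<\infty$, the limits $\omega^\infty=\lim_{t\to\infty}\omega(t)$ and $\eta^\infty=\lim_{t\to\infty}\eta(t)$ exist and $\omega^\infty=\bar u$, $\eta^\infty=\bar y$.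
   Context: Notation: $\mathbb{R}_{\geq 0}=[0,+\infty)$; in any metric space $M$ the distance between $a$ and $b$ is written $|a-b|$; $[\mathbb{R}_{\geq 0}\to M]$ is the set of all functions $\mathbb{R}_{\geq 0}\to M$. The asymptotic amplitude of $\omega:\mathbb{R}_{\geq 0}\to M$ is $$\|\omega\|_{\mathrm{aa}} := \limsup_{s,t\to\infty}|\omega(t)-\omega(s)| = \lim_{T\to\infty}\Big(\sup_{t,s\geq T}|\omega(t)-\omega(s)|\Big)\in[0,\infty].$$ When $M$ is complete, $\|\omega\|_{\mathrm{aa}}=0$ if and only if $\lim_{t\to\infty}\omega(t)$ exists; in that case $\omega^\infty:=\lim_{t\to\infty}\omega(t)$. $\mathcal{K}_\infty$ is the class of continuous, strictly increasing, unbounded functions $\gamma:\mathbb{R}_{\geq 0}\to\mathbb{R}_{\geq 0}$ with $\gamma(0)=0$; one sets $\gamma(+\infty)=+\infty$. A behavior with input-value space $\mathcal{U}$ and output-value space $\mathcal{Y}$ (complete metric spaces) is a relation $\mathcal{R}\subseteq[\mathbb{R}_{\geq 0}\to\mathcal{U}]\times[\mathbb{R}_{\geq 0}\to\mathcal{Y}]$; its elements $(\omega,\eta)$ are called input/output pairs. The behavior $\mathcal{R}$ has Cauchy gain $\gamma\in\mathcal{K}_\infty$ if $\|\eta\|_{\mathrm{aa}}\leq\gamma(\|\omega\|_{\mathrm{aa}})$ for all $(\omega,\eta)\in\mathcal{R}$. It has incremental limit gain $\kappa\in\mathcal{K}_\infty$ if $$\limsup_{t\to\infty}|\eta_1(t)-\eta_2(t)|\leq\kappa(|\omega_1^\infty-\omega_2^\infty|)$$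 whenever $(\omega_1,\eta_1),(\omega_2,\eta_2)\in\mathcal{R}$ are any two pairs with $\|\omega_1\|_{\mathrm{aa}}=\|\omega_2\|_{\mathrm{aa}}=0$. For a behavior $\mathcal{S}$ with input-value space $\mathcal{Y}$ and output-value space $\mathcal{U}$, the inverse behavior $\mathcal{S}^{-1}$ (input-value space $\mathcal{U}$, output-value space $\mathcal{Y}$) consists of all pairs $(\omega,\eta)$ such that $(\eta,\omega)\in\mathcal{S}$. *)

theory Defs
  imports "HOL-Analysis.Analysis"
begin

text \<open>A function on the half-line is represented by its extensional extension to
  \<^typ>\<open>real\<close>, that is, it takes the value \<^const>\<open>undefined\<close> at negative arguments.\<close>

definition signals :: "(real \<Rightarrow> 'm) set" where
  "signals = {0..} \<rightarrow>\<^sub>E UNIV"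

definition behavior :: "((real \<Rightarrow> 'u) \<times> (real \<Rightarrow> 'y)) set \<Rightarrow> bool" where
  "behavior R \<longleftrightarrow> R \<subseteq> signals \<times> signals"

definition asymp_amplitude :: "(real \<Rightarrow> 'm::metric_space) \<Rightarrow> ennreal" where
  "asymp_amplitude \<omega> =
     Limsup (at_top \<times>\<^sub>F at_top) (\<lambda>(s, t). ennreal (dist (\<omega> t) (\<omega> s)))"

definition limit_value :: "(real \<Rightarrow> 'm::t2_space) \<Rightarrow> 'm" where
  "limit_value \<omega> = Lim at_top \<omega>"

text \<open>Only the values of the function on the half-line matter here.\<close>

definition class_K_inf :: "(real \<Rightarrow> real) set" where
  "class_K_inf = {\<gamma>. \<gamma> \<in> {0..} \<rightarrow> {0..} \<and> continuous_on {0..} \<gamma> \<and>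
     strict_mono_on {0..} \<gamma> \<and> \<not> bdd_above (\<gamma> ` {0..}) \<and> \<gamma> 0 = 0}"

definition gain_ext :: "(real \<Rightarrow> real) \<Rightarrow> ennreal \<Rightarrow> ennreal" where
  "gain_ext \<gamma> x = (if x = \<infinity> then \<infinity> else ennreal (\<gamma> (enn2real x)))"

definition has_Cauchy_gain ::
    "((real \<Rightarrow> 'u::metric_space) \<times> (real \<Rightarrow> 'y::metric_space)) set \<Rightarrow> (real \<Rightarrow> real) \<Rightarrow> bool" where
  "has_Cauchy_gain R \<gamma> \<longleftrightarrow>
     (\<forall>(\<omega>, \<eta>) \<in> R. asymp_amplitude \<eta> \<le> gain_ext \<gamma> (asymp_amplitude \<omega>))"

definition has_incremental_limit_gain ::
    "((real \<Rightarrow> 'u::metric_space) \<times> (real \<Rightarrow> 'y::metric_space)) set \<Rightarrow> (real \<Rightarrow> real) \<Rightarrow> bool" where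
  "has_incremental_limit_gain R \<kappa> \<longleftrightarrow>
     (\<forall>(\<omega>1, \<eta>1) \<in> R. \<forall>(\<omega>2, \<eta>2) \<in> R.
        asymp_amplitude \<omega>1 = 0 \<longrightarrow> asymp_amplitude \<omega>2 = 0 \<longrightarrow>
        Limsup at_top (\<lambda>t. ennreal (dist (\<eta>1 t) (\<eta>2 t)))
          \<le> ennreal (\<kappa> (dist (limit_value \<omega>1) (limit_value \<omega>2))))"

lemma asymp_amplitude_eq_INF:
  "asymp_amplitude \<omega> = (INF T. SUP t\<in>{T..}. SUP s\<in>{T..}. ennreal (dist (\<omega> t) (\<omega> s)))"
    (is "_ = (INF T. ?G T)")
proof (rule antisym)
  show "asymp_amplitude \<omega> \<le> (INF T. ?G T)"
  proof (rule INF_greatest)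
    fix T :: real
    have "\<forall>\<^sub>F x in at_top \<times>\<^sub>F at_top.
        (case x of (s, t) \<Rightarrow> ennreal (dist (\<omega> t) (\<omega> s))) \<le> ?G T"
      unfolding eventually_prod_filter
    proof (intro exI conjI allI impI)
      show "eventually (\<lambda>t. T \<le> t) at_top" "eventually (\<lambda>t. T \<le> t) at_top"
        by (rule eventually_ge_at_top)+
      fix s t assume "T \<le> s" "T \<le> t"
      then have "ennreal (dist (\<omega> t) (\<omega> s)) \<le> ?G T"
        by (intro SUP_upper2[of t] SUP_upper[of s]) simp_all
      then show "(case (s, t) of (s, t) \<Rightarrow> ennreal (dist (\<omega> t) (\<omega> s))) \<le> ?G T"
        by simp
    qed
    then show "asymp_amplitude \<omega> \<le> ?G T"
      unfolding asymp_amplitude_def by (rule Limsup_bounded)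
  qed
  show "(INF T. ?G T) \<le> asymp_amplitude \<omega>"
    unfolding asymp_amplitude_def Limsup_def
  proof (rule INF_greatest)
    fix P :: "real \<times> real \<Rightarrow> bool"
    assume "P \<in> {P. eventually P (at_top \<times>\<^sub>F at_top)}"
    then obtain A B where "eventually A at_top" "eventually B at_top"
      and AB: "\<And>x y. A x \<Longrightarrow> B y \<Longrightarrow> P (x, y)"
      by (auto simp: eventually_prod_filter)
    then have "\<forall>\<^sub>F x in at_top. A x \<and> B x"
      by (simp add: eventually_conj)
    then obtain T where T: "\<And>x. T \<le> x \<Longrightarrow> A x \<and> B x"
      by (auto simp: eventually_at_top_linorder)
    have "?G T \<le> Sup ((\<lambda>(s, t). ennreal (dist (\<omega> t) (\<omega> s))) ` Collect P)"
    proof (intro SUP_least)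
      fix t s assume "t \<in> {T..}" "s \<in> {T..}"
      then have "P (s, t)" using T AB by auto
      then show "ennreal (dist (\<omega> t) (\<omega> s))
          \<le> Sup ((\<lambda>(s, t). ennreal (dist (\<omega> t) (\<omega> s))) ` Collect P)"
        by (intro Sup_upper) (auto intro!: image_eqI[of _ _ "(s, t)"])
    qed
    then show "(INF T. ?G T) \<le> Sup ((\<lambda>(s, t). ennreal (dist (\<omega> t) (\<omega> s))) ` Collect P)"
      by (rule INF_lower2[OF UNIV_I])
  qed
qed

end

theory Submission
  imports Defs
begin

text \<open>
  Both the convergence of the signals and the uniqueness of their limits are instances of one
  scalar fact (\<open>small_gain_vanishing\<close>): if two nonnegative reals bound each other through gain
  functions whose composition lies strictly below the identity, then both are zero.
  For a single pair \<open>(\<omega>, \<eta>)\<close> of the feedback interconnection it is applied to the two asymptotic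
  amplitudes. They vanish, so by completeness \<open>\<omega>\<close> and \<open>\<eta>\<close> converge. The
  finiteness of the amplitude of \<open>\<omega>\<close> enters here, since the infinite value satisfies the
  gain inequalities too. For two such pairs, both now convergent, it is applied
  to the distances between the input limits and between the output limits, which the
  incremental limit gains bound in terms of each other. So all pairs share the same limits,
  and any one of them can serve to define \<open>u\<close> and \<open>y\<close>.
\<close>

lemma class_K_inf_nonneg: "\<gamma> \<in> class_K_inf \<Longrightarrow> 0 \<le> a \<Longrightarrow> 0 \<le> \<gamma> a"
  by (auto simp: class_K_inf_def)

lemma class_K_inf_mono: "\<gamma> \<in> class_K_inf \<Longrightarrow> 0 \<le> a \<Longrightarrow> a \<le> b \<Longrightarrow> \<gamma> a \<le> \<gamma> b"
  using strict_mono_on_leD[of "{0..}" \<gamma> a b] by (auto simp: class_K_inf_def)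

lemma class_K_inf_zero: "\<gamma> \<in> class_K_inf \<Longrightarrow> \<gamma> 0 = 0"
  by (simp add: class_K_inf_def)

text \<open>
  The two bounds combine to \<open>b \<le> \<gamma>1 (\<gamma>2 b)\<close>, which the contraction condition
  permits only for \<open>b = 0\<close>; then \<open>a \<le> \<gamma>2 0 = 0\<close>.
\<close>

lemma small_gain_vanishing:
  fixes a b :: real
  assumes "\<gamma>1 \<in> class_K_inf" "\<gamma>2 \<in> class_K_inf"
    and contraction: "\<And>r. r > 0 \<Longrightarrow> \<gamma>1 (\<gamma>2 r) < r"
    and "0 \<le> a" "0 \<le> b" "b \<le> \<gamma>1 a" "a \<le> \<gamma>2 b"
  shows "a = 0" "b = 0"
proof -
  have "b \<le> \<gamma>1 (\<gamma>2 b)"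
    using class_K_inf_mono[OF assms(1) \<open>0 \<le> a\<close> \<open>a \<le> \<gamma>2 b\<close>] \<open>b \<le> \<gamma>1 a\<close> by simp
  with contraction[of b] \<open>0 \<le> b\<close> show "b = 0" by fastforce
  with \<open>a \<le> \<gamma>2 b\<close> \<open>0 \<le> a\<close> class_K_inf_zero[OF assms(2)] show "a = 0" by simp
qed

lemma ennreal_small_gain_vanishing:
  fixes a b :: ennreal
  assumes "\<gamma>1 \<in> class_K_inf" "\<gamma>2 \<in> class_K_inf"
    and contraction: "\<And>r. r > 0 \<Longrightarrow> \<gamma>1 (\<gamma>2 r) < r"
    and "a < \<infinity>" "b \<le> gain_ext \<gamma>1 a" "a \<le> gain_ext \<gamma>2 b"
  shows "a = 0" "b = 0"
proof -
  obtain x where x: "a = ennreal x" "0 \<le> x"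
    using \<open>a < \<infinity>\<close> by (cases a) auto
  then have b_le: "b \<le> ennreal (\<gamma>1 x)"
    using \<open>b \<le> gain_ext \<gamma>1 a\<close> by (simp add: gain_ext_def)
  then obtain y where y: "b = ennreal y" "0 \<le> y"
    by (cases b) (auto simp: top_unique)
  have "y \<le> \<gamma>1 x"
    using b_le y class_K_inf_nonneg[OF assms(1) x(2)] by simp
  moreover have "x \<le> \<gamma>2 y"
    using \<open>a \<le> gain_ext \<gamma>2 b\<close> x y class_K_inf_nonneg[OF assms(2) y(2)]
    by (simp add: gain_ext_def)
  ultimately have "x = 0" "y = 0"
    using small_gain_vanishing[OF assms(1,2) contraction x(2) y(2)] by auto
  with x y show "a = 0" "b = 0" by simp_all
qed

text \<open>
  Vanishing amplitude says exactly that the image of \<open>at_top\<close> under \<open>\<omega>\<close> is a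
  Cauchy filter, so completeness in its filter form supplies the limit.
\<close>

lemma asymp_amplitude_zero_imp_convergent:
  fixes \<omega> :: "real \<Rightarrow> 'm::complete_space"
  assumes "asymp_amplitude \<omega> = 0"
  obtains l where "(\<omega> \<longlongrightarrow> l) at_top"
proof -
  have "cauchy_filter (filtermap \<omega> at_top)"
    unfolding cauchy_filter_metric_filtermap
  proof (intro allI impI)
    fix e :: real assume "e > 0"
    with assms have "asymp_amplitude \<omega> < ennreal e" by simp
    then have "\<forall>\<^sub>F x in at_top \<times>\<^sub>F at_top.
        (case x of (s, t) \<Rightarrow> ennreal (dist (\<omega> t) (\<omega> s))) < ennreal e"
      unfolding asymp_amplitude_def by (rule Limsup_lessD)
    then obtain P Q where "eventually P at_top" "eventually Q at_top"
      and PQ: "\<And>s t. P s \<Longrightarrow> Q t \<Longrightarrow> ennreal (dist (\<omega> t) (\<omega> s)) < ennreal e"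
      by (auto simp: eventually_prod_filter)
    then have "\<forall>\<^sub>F t in at_top. P t \<and> Q t" by (simp add: eventually_conj)
    moreover have "dist (\<omega> s) (\<omega> t) < e" if "P s \<and> Q s" "P t \<and> Q t" for s t
      using PQ[of t s] that \<open>e > 0\<close> by (simp add: ennreal_less_iff)
    ultimately show "\<exists>P. eventually P at_top \<and> (\<forall>x y. P x \<and> P y \<longrightarrow> dist (\<omega> x) (\<omega> y) < e)"
      by blast
  qed
  moreover have "complete (UNIV :: 'm set)" by (rule complete_UNIV)
  ultimately obtain l where "filtermap \<omega> at_top \<le> nhds l"
    unfolding complete_uniform by (force simp: filtermap_bot_iff)
  then show ?thesis using that by (simp add: filterlim_def)
qed

lemma incremental_limit_gain_dist_le:
  assumes "has_incremental_limit_gain R \<kappa>" "\<kappa> \<in> class_K_inf"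
    and "(\<omega>1, \<eta>1) \<in> R" "(\<omega>2, \<eta>2) \<in> R"
    and "asymp_amplitude \<omega>1 = 0" "asymp_amplitude \<omega>2 = 0"
    and "(\<omega>1 \<longlongrightarrow> u1) at_top" "(\<omega>2 \<longlongrightarrow> u2) at_top"
    and "(\<eta>1 \<longlongrightarrow> y1) at_top" "(\<eta>2 \<longlongrightarrow> y2) at_top"
  shows "dist y1 y2 \<le> \<kappa> (dist u1 u2)"
proof -
  have limits: "limit_value \<omega>1 = u1" "limit_value \<omega>2 = u2"
    unfolding limit_value_def using assms(7,8) by (simp_all add: tendsto_Lim)
  have "((\<lambda>t. ennreal (dist (\<eta>1 t) (\<eta>2 t))) \<longlongrightarrow> ennreal (dist y1 y2)) at_top"
    using assms(9,10) by (intro tendsto_ennrealI tendsto_dist)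
  then have "Limsup at_top (\<lambda>t. ennreal (dist (\<eta>1 t) (\<eta>2 t))) = ennreal (dist y1 y2)"
    by (intro lim_imp_Limsup) simp_all
  moreover have "Limsup at_top (\<lambda>t. ennreal (dist (\<eta>1 t) (\<eta>2 t))) \<le> ennreal (\<kappa> (dist u1 u2))"
    using bspec[OF bspec[OF assms(1)[unfolded has_incremental_limit_gain_def] assms(3),
      unfolded prod.case] assms(4)] assms(5,6) limits by simp
  ultimately show ?thesis
    using class_K_inf_nonneg[OF assms(2), of "dist u1 u2"] by simp
qed

theorem lemma1p5:
  fixes R :: "((real \<Rightarrow> 'u::complete_space) \<times> (real \<Rightarrow> 'y::complete_space)) set"
    and S :: "((real \<Rightarrow> 'y) \<times> (real \<Rightarrow> 'u)) set"
    and \<gamma>1 \<gamma>2 \<kappa>1 \<kappa>2 :: "real \<Rightarrow> real"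
  assumes "behavior R" and "behavior S"
    and "\<gamma>1 \<in> class_K_inf" and "\<gamma>2 \<in> class_K_inf"
    and "\<kappa>1 \<in> class_K_inf" and "\<kappa>2 \<in> class_K_inf"
    and "has_Cauchy_gain R \<gamma>1" and "has_Cauchy_gain S \<gamma>2"
    and "has_incremental_limit_gain R \<kappa>1" and "has_incremental_limit_gain S \<kappa>2"
    and "\<And>r. r > 0 \<Longrightarrow> \<gamma>1 (\<gamma>2 r) < r"
    and "\<And>r. r > 0 \<Longrightarrow> \<kappa>1 (\<kappa>2 r) < r"
  shows "\<exists>(u::'u) (y::'y). \<forall>(\<omega>, \<eta>) \<in> R \<inter> S\<inverse>.
           asymp_amplitude \<omega> < \<infinity> \<longrightarrow> (\<omega> \<longlongrightarrow> u) at_top \<and> (\<eta> \<longlongrightarrow> y) at_top"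
proof -
  define loop where "loop = {(\<omega>, \<eta>). (\<omega>, \<eta>) \<in> R \<and> (\<eta>, \<omega>) \<in> S \<and> asymp_amplitude \<omega> < \<infinity>}"
  have amplitudes: "asymp_amplitude \<omega> = 0" "asymp_amplitude \<eta> = 0" if "(\<omega>, \<eta>) \<in> loop" for \<omega> \<eta>
  proof -
    have "asymp_amplitude \<eta> \<le> gain_ext \<gamma>1 (asymp_amplitude \<omega>)"
      using that assms(7) by (auto simp: loop_def has_Cauchy_gain_def)
    moreover have "asymp_amplitude \<omega> \<le> gain_ext \<gamma>2 (asymp_amplitude \<eta>)"
      using that assms(8) by (auto simp: loop_def has_Cauchy_gain_def)
    moreover have "asymp_amplitude \<omega> < \<infinity>" using that by (simp add: loop_def)
    ultimately show "asymp_amplitude \<omega> = 0" "asymp_amplitude \<eta> = 0"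
      using ennreal_small_gain_vanishing[OF assms(3,4,11)] by blast+
  qed
  have limits_unique: "u1 = u2 \<and> y1 = y2"
    if "(\<omega>1, \<eta>1) \<in> loop" "(\<omega>2, \<eta>2) \<in> loop"
      "(\<omega>1 \<longlongrightarrow> u1) at_top" "(\<omega>2 \<longlongrightarrow> u2) at_top" "(\<eta>1 \<longlongrightarrow> y1) at_top" "(\<eta>2 \<longlongrightarrow> y2) at_top"
    for \<omega>1 \<eta>1 \<omega>2 \<eta>2 u1 u2 y1 y2
  proof -
    have in_RS: "(\<omega>1, \<eta>1) \<in> R" "(\<omega>2, \<eta>2) \<in> R" "(\<eta>1, \<omega>1) \<in> S" "(\<eta>2, \<omega>2) \<in> S"
      using that(1,2) by (simp_all add: loop_def)
    have "dist y1 y2 \<le> \<kappa>1 (dist u1 u2)"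
      using in_RS assms(9,5)
      by (intro incremental_limit_gain_dist_le[OF _ _ _ _ amplitudes(1)[OF that(1)]
            amplitudes(1)[OF that(2)] that(3-6)])
    moreover have "dist u1 u2 \<le> \<kappa>2 (dist y1 y2)"
      using in_RS assms(10,6)
      by (intro incremental_limit_gain_dist_le[OF _ _ _ _ amplitudes(2)[OF that(1)]
            amplitudes(2)[OF that(2)] that(5,6,3,4)])
    ultimately show ?thesis
      using small_gain_vanishing[OF assms(5,6,12), of "dist u1 u2" "dist y1 y2"] by simp
  qed
  have convergent: "\<exists>u y. (\<omega> \<longlongrightarrow> u) at_top \<and> (\<eta> \<longlongrightarrow> y) at_top" if "(\<omega>, \<eta>) \<in> loop" for \<omega> \<eta>
    using asymp_amplitude_zero_imp_convergent[OF amplitudes(1)[OF that]]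
      asymp_amplitude_zero_imp_convergent[OF amplitudes(2)[OF that]] by metis
  have "\<exists>u y. \<forall>(\<omega>, \<eta>) \<in> loop. (\<omega> \<longlongrightarrow> u) at_top \<and> (\<eta> \<longlongrightarrow> y) at_top"
  proof (cases "loop = {}")
    case False
    then obtain \<omega>0 \<eta>0 where in_loop: "(\<omega>0, \<eta>0) \<in> loop" by auto
    then obtain u y where "(\<omega>0 \<longlongrightarrow> u) at_top" "(\<eta>0 \<longlongrightarrow> y) at_top"
      using convergent by blast
    then have "(\<omega> \<longlongrightarrow> u) at_top \<and> (\<eta> \<longlongrightarrow> y) at_top" if "(\<omega>, \<eta>) \<in> loop" for \<omega> \<eta>
      using convergent[OF that] limits_unique[OF in_loop that] by blast
    then show ?thesis by blast
  qed simp
  then show ?thesis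
    unfolding loop_def by (elim ex_forward) auto
qed

end
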